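(* Let $p$ be a given positive integer. For every integer $t\geq 1$ let $f_t$ be the number of $(t,t+1,\ldots,t+p)$-core partitions; set $f_0=1$ and $f_t=0$ for $t<0$. Then for every $t\geq 1$, $$f_t=\sum_{i=1}^{p-1}f_{t-i}+\sum_{j=0}^{t-p}f_jf_{t-p-j},$$ where empty sums are $0$ (in particular the second sum is $0$ if $t<p$). The generating function of $f_t$ is $$\sum_{t\geq 0}f_tx^t=\frac{1-\sum_{1\leq i\leq p-1}x^i-\sqrt{\left(1-\sum_{1\leq i\leq p-1}x^i\right)^2-4x^p}}{2x^p}$$ (as a formal power series in $x$).
   Context: A partition is a finite non-increasing sequence of positive integers $\lambda=(\lambda_1,\ldots,\lambda_r)$; the empty partition ($r=0$) is allowed. Its Young diagram is the left-justified array of boxes with $\lambda_i$ boxes in the $i$-th row. The hook length of a box is the number of boxes that are directly to its right in the same row, or directly below it in the same column, or the box itself. For a positive integer $t$, $\lambda$ is a $t$-core partition if none of its hook lengths is a multiple of $t$ (so the empty partition is a $t$-core for every $t$). $\lambda$ is a $(t_1,\ldots,t_m)$-core partition if it is simultaneously a $t_i$-core partition for every $1\leq i\leq m$. Partitions of all sizes are counted together. The square root of a formal power series with constant term $1$ is the one with constant term $1$. *)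

theory Defs
  imports Complex_Main "HOL-Computational_Algebra.Formal_Power_Series"
begin

definition is_partition :: "nat list \<Rightarrow> bool" where
  "is_partition l \<longleftrightarrow> sorted_wrt (\<ge>) l \<and> (\<forall>k \<in> set l. k > 0)"

text \<open>Boxes are pairs (row, column), both counted from 0.\<close>

definition young_diagram :: "nat list \<Rightarrow> (nat \<times> nat) set" where
  "young_diagram l = {(i, j). i < length l \<and> j < l ! i}"

definition hook_length :: "nat list \<Rightarrow> nat \<times> nat \<Rightarrow> nat" where
  "hook_length l = (\<lambda>(i, j). card {(i', j') \<in> young_diagram l.
     (i' = i \<and> j' \<ge> j) \<or> (j' = j \<and> i' \<ge> i)})"

definition is_core :: "nat \<Rightarrow> nat list \<Rightarrow> bool" where
  "is_core t l \<longleftrightarrow> is_partition l \<and> (\<forall>b \<in> young_diagram l. \<not> t dvd hook_length l b)"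

definition is_simultaneous_core :: "nat set \<Rightarrow> nat list \<Rightarrow> bool" where
  "is_simultaneous_core T l \<longleftrightarrow> is_partition l \<and> (\<forall>t \<in> T. is_core t l)"

text \<open>The index is an integer so that the recurrence can refer to negative indices.\<close>

definition num_cores :: "nat \<Rightarrow> int \<Rightarrow> nat" where
  "num_cores p t =
     (if t < 0 then 0
      else if t = 0 then 1
      else card {l. is_simultaneous_core {nat t..nat t + p} l})"

text \<open>For a series with constant term 1 this is the square root with constant term 1,
  as the two lemmas below confirm.\<close>

definition fps_sqrt :: "real fps \<Rightarrow> real fps" where
  "fps_sqrt a = fps_radical root 2 a"

lemma fps_sqrt_nth_0: "fps_nth a 0 = 1 \<Longrightarrow> fps_nth (fps_sqrt a) 0 = 1"
  by (simp add: fps_sqrt_def numeral_2_eq_2)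

lemma fps_sqrt_power2: "fps_nth a 0 = 1 \<Longrightarrow> fps_sqrt a ^ 2 = a"
  using power_radical[of a root 1] by (simp add: fps_sqrt_def numeral_2_eq_2)

end

theory Submission
  imports Defs
begin

text \<open>Encode a partition by the set \<open>S\<close> of hook lengths of its first column. It is a \<open>t\<close>-core iff \<open>S\<close> is
  closed under subtracting \<open>t\<close> from elements \<open>\<ge> t\<close>, where \<open>0\<close> counts as a non-element. So the
  \<open>(t, \<dots>, t + p)\<close>-cores are the order ideals of the numbers not in the semigroup generated by
  \<open>t, \<dots>, t + p\<close>. These numbers form a truncated pyramid whose rows have \<open>t - 1, t - 1 - p, t - 1 - 2 p, \<dots>\<close>
  entries, each entry covering \<open>p + 1\<close> consecutive entries of the row before. Cutting at the first
  missing entry of the bottom row splits an ideal into an ideal over the full entries to the left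
  and an ideal of the pyramid to the right, which is the recurrence.
  For the generating function \<open>F\<close> the recurrence reads \<open>x^p F^2 - A F + 1 = 0\<close>; completing the square
  gives \<open>(A - 2 x^p F)^2 = A^2 - 4 x^p\<close>, and \<open>A - 2 x^p F\<close> has constant term \<open>1\<close>.\<close>

section \<open>First-column hook lengths of a partition\<close>

text \<open>For a partition, \<open>x + length xs\<close> is the hook length of the first box of the
  top row: \<open>x\<close> boxes in the row and one box below for each later row.\<close>

fun beta_set :: "nat list \<Rightarrow> nat set" where
  "beta_set [] = {}"
| "beta_set (x # xs) = insert (x + length xs) (beta_set xs)"

lemma finite_beta_set [simp]: "finite (beta_set l)"
  by (induction l) auto

lemma is_partition_Nil [simp]: "is_partition []"
  by (simp add: is_partition_def)

lemma is_partition_Cons: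
  "is_partition (x # xs) \<longleftrightarrow> x > 0 \<and> (\<forall>y \<in> set xs. y \<le> x) \<and> is_partition xs"
  by (auto simp: is_partition_def)

lemma beta_set_less:
  assumes "is_partition l" "\<forall>y \<in> set l. y \<le> x" "b \<in> beta_set l"
  shows "b < x + length l"
  using assms by (induction l) (auto simp: is_partition_Cons)

lemma beta_set_pos: "is_partition l \<Longrightarrow> 0 \<notin> beta_set l"
  by (induction l) (auto simp: is_partition_Cons)

lemma card_beta_set: "is_partition l \<Longrightarrow> card (beta_set l) = length l"
proof (induction l)
  case (Cons x xs)
  then have "x + length xs \<notin> beta_set xs"
    using beta_set_less[of xs x "x + length xs"] by (auto simp: is_partition_Cons)
  with Cons show ?case by (simp add: is_partition_Cons)
qed simp

lemma Max_beta_set_Cons: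
  assumes "is_partition (x # xs)"
  shows "Max (beta_set (x # xs)) = x + length xs"
  using assms beta_set_less[of xs x] by (intro Max_eqI) (auto simp: is_partition_Cons less_imp_le)

text \<open>The cardinality of the set is the number of rows and its maximum then determines the top
  row; removing the maximum leaves the set of the remaining rows.\<close>

lemma beta_set_inj:
  assumes "is_partition l" "is_partition m" "beta_set l = beta_set m"
  shows "l = m"
  using assms
proof (induction l arbitrary: m)
  case Nil
  then show ?case by (cases m) auto
next
  case (Cons x xs)
  then obtain y ys where m: "m = y # ys" by (cases m) auto
  have "length xs = length ys"
    using card_beta_set[OF Cons.prems(1)] card_beta_set[OF Cons.prems(2)] Cons.prems(3) m by simp
  moreover have "x + length xs = y + length ys"
    using Max_beta_set_Cons[of x xs] Max_beta_set_Cons[of y ys] Cons.prems m by metis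
  ultimately have xy: "x = y" "length xs = length ys" by auto
  have "x + length xs \<notin> beta_set xs"
    using Cons.prems(1) beta_set_less[of xs x "x + length xs"] by (auto simp: is_partition_Cons)
  moreover have "y + length ys \<notin> beta_set ys"
    using Cons.prems(2) m beta_set_less[of ys y "y + length ys"] by (auto simp: is_partition_Cons)
  ultimately have "beta_set xs = beta_set ys"
    using Cons.prems(3) m xy by (auto simp: insert_eq_iff)
  then show ?case using Cons m xy by (auto simp: is_partition_Cons)
qed

lemma beta_set_surj:
  assumes "finite S" "0 \<notin> S"
  shows "\<exists>l. is_partition l \<and> beta_set l = S"
  using assms
proof (induction S rule: finite_linorder_max_induct)
  case empty
  then show ?case by (intro exI[of _ "[]"]) simp
next
  case (insert b A)
  then obtain l where l: "is_partition l" "beta_set l = A" by auto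
  \<comment> \<open>The new top row must have length \<open>b - length l\<close>. It is at least the
    old top row \<open>y\<close> because \<open>b\<close> exceeds \<open>y + length ys\<close>; over
    the empty partition it is positive because \<open>0\<close> is excluded.\<close>
  have "is_partition ((b - length l) # l) \<and> b - length l + length l = b"
  proof (cases l)
    case Nil
    with insert show ?thesis by (auto simp: is_partition_Cons)
  next
    case (Cons y ys)
    then have "y + length ys \<in> A" using l by auto
    then have "y + length ys < b" using insert by auto
    with l Cons show ?thesis by (fastforce simp: is_partition_Cons)
  qed
  with l show ?case by (intro exI[of _ "(b - length l) # l"]) auto
qed

lemma bij_betw_beta_set:
  "bij_betw beta_set {l. is_partition l} {S. finite S \<and> 0 \<notin> S}"
  unfolding bij_betw_def
  using beta_set_inj beta_set_surj beta_set_pos by (auto simp: inj_on_def image_iff) metis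

lemma beta_set_conv_nth:
  "beta_set l = (\<lambda>i. l ! i + (length l - Suc i)) ` {..<length l}"
proof (induction l)
  case (Cons x xs)
  show ?case
    by (simp add: lessThan_Suc_eq_insert_0 image_image Cons)
qed simp

section \<open>Hook lengths and the core condition in terms of the set\<close>

definition conjugate_part :: "nat list \<Rightarrow> nat \<Rightarrow> nat" where
  "conjugate_part l j = card {i. i < length l \<and> j < l ! i}"

lemma down_closed_nat_eq_lessThan:
  fixes A :: "nat set"
  assumes "finite A" "\<And>i k. i \<in> A \<Longrightarrow> k < i \<Longrightarrow> k \<in> A"
  shows "A = {..<card A}"
proof -
  have "i < card A" if "i \<in> A" for i
    using card_mono[of A "{..i}"] assms that by (force simp: le_less)
  then show ?thesis
    by (intro card_subset_eq) auto
qed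

lemma is_partition_nth_mono:
  "is_partition l \<Longrightarrow> i \<le> k \<Longrightarrow> k < length l \<Longrightarrow> l ! k \<le> l ! i"
  by (cases "i = k") (auto simp: is_partition_def sorted_wrt_iff_nth_less)

text \<open>Rows get shorter downwards, so the rows that reach column \<open>j\<close> form an
  initial segment.\<close>

lemma less_nth_iff_conjugate_part:
  assumes "is_partition l"
  shows "i < length l \<and> j < l ! i \<longleftrightarrow> i < conjugate_part l j"
proof -
  have "{i. i < length l \<and> j < l ! i} = {..<conjugate_part l j}"
    unfolding conjugate_part_def
    by (rule down_closed_nat_eq_lessThan)
       (use is_partition_nth_mono[OF assms] in \<open>fastforce simp: le_less\<close>)+
  then show ?thesis by auto
qed

lemma hook_length_eq:
  assumes "is_partition l" "i < length l" "j < l ! i"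
  shows "hook_length l (i, j) = (l ! i - j) + (conjugate_part l j - Suc i)"
proof -
  have "{(i', j') \<in> young_diagram l. (i' = i \<and> j' \<ge> j) \<or> (j' = j \<and> i' \<ge> i)}
      = Pair i ` {j..<l ! i} \<union> (\<lambda>k. (k, j)) ` {Suc i..<conjugate_part l j}" (is "?H = _")
    using assms
    by (auto simp: young_diagram_def image_iff Suc_le_eq simp flip: less_nth_iff_conjugate_part)
  moreover have "card (Pair i ` {j..<l ! i} \<union> (\<lambda>k. (k, j)) ` {Suc i..<conjugate_part l j})
      = card (Pair i ` {j..<l ! i}) + card ((\<lambda>k. (k, j)) ` {Suc i..<conjugate_part l j})"
    by (rule card_Un_disjoint) auto
  ultimately show ?thesis
    by (simp add: hook_length_def card_image inj_on_def)
qed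

lemma conjugate_part_le: "conjugate_part l j \<le> length l"
  unfolding conjugate_part_def using card_mono[of "{..<length l}" "{i. i < length l \<and> j < l ! i}"]
  by auto

lemma conjugate_part_antimono: "j \<le> k \<Longrightarrow> conjugate_part l k \<le> conjugate_part l j"
  unfolding conjugate_part_def by (rule card_mono) auto

text \<open>The hook length at \<open>(i, j)\<close> is the difference between the element of \<open>beta_set l\<close> that belongs to row
  \<open>i\<close> and the gap that belongs to column \<open>j\<close>.\<close>

lemma beta_set_gaps_below:
  assumes "is_partition l" "i < length l"
  defines "b \<equiv> l ! i + (length l - Suc i)"
  shows "{y. y < b \<and> y \<notin> beta_set l} = (\<lambda>j. j + (length l - conjugate_part l j)) ` {..<l ! i}"
    (is "?G = ?y ` _")
proof (rule sym, rule card_subset_eq)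
  show "finite ?G" by simp
  have inj: "inj_on ?y {..<l ! i}"
  proof (rule linorder_inj_onI')
    fix j k :: nat assume "j < k"
    then show "?y j \<noteq> ?y k"
      using conjugate_part_antimono[of j k l] by linarith
  qed
  show "?y ` {..<l ! i} \<subseteq> ?G"
  proof safe
    fix j assume "j < l ! i"
    then have "i < conjugate_part l j"
      using less_nth_iff_conjugate_part assms by blast
    then show "?y j < b"
      using conjugate_part_le[of l j] \<open>j < l ! i\<close> assms by simp
    assume "?y j \<in> beta_set l"
    then obtain k where k: "k < length l" "?y j = l ! k + (length l - Suc k)"
      by (auto simp: beta_set_conv_nth)
    \<comment> \<open>Row \<open>k\<close> contributes a number above the gap of column
      \<open>j\<close> if it reaches that column, and a number below the gap if it does not.\<close>
    show False
      using less_nth_iff_conjugate_part[OF assms(1), of k j] k conjugate_part_le[of l j] by linarith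
  qed
  \<comment> \<open>Equality follows by counting: the elements below \<open>b\<close> belong to the
    rows below row \<open>i\<close>, which leaves \<open>l ! i\<close> gaps, one for each
    column.\<close>
  have "{y. y < b \<and> y \<in> beta_set l} = (\<lambda>k. l ! k + (length l - Suc k)) ` {Suc i..<length l}"
  proof safe
    fix y assume y: "y < b" "y \<in> beta_set l"
    then obtain k where k: "k < length l" "y = l ! k + (length l - Suc k)"
      by (auto simp: beta_set_conv_nth)
    with y is_partition_nth_mono[OF assms(1), of k i] assms(2) have "i < k"
      unfolding b_def by linarith
    with k show "y \<in> (\<lambda>k. l ! k + (length l - Suc k)) ` {Suc i..<length l}" by auto
  next
    fix k assume k: "k \<in> {Suc i..<length l}"
    then show "l ! k + (length l - Suc k) < b"
      using is_partition_nth_mono[OF assms(1), of i k] unfolding b_def by auto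
    show "l ! k + (length l - Suc k) \<in> beta_set l"
      using k by (auto simp: beta_set_conv_nth)
  qed
  moreover have "inj_on (\<lambda>k. l ! k + (length l - Suc k)) {Suc i..<length l}"
  proof (rule linorder_inj_onI')
    fix k m assume "k \<in> {Suc i..<length l}" "m \<in> {Suc i..<length l}" "k < m"
    then show "l ! k + (length l - Suc k) \<noteq> l ! m + (length l - Suc m)"
      using is_partition_nth_mono[OF assms(1), of k m] by auto
  qed
  ultimately have "card {y. y < b \<and> y \<in> beta_set l} = length l - Suc i"
    by (simp only: card_image) simp
  moreover have "{..<b} = ?G \<union> {y. y < b \<and> y \<in> beta_set l}" by auto
  then have "card {..<b} = card ?G + card {y. y < b \<and> y \<in> beta_set l}"
    by (metis (no_types, lifting) card_Un_disjoint disjoint_iff finite_Un finite_lessThan mem_Collect_eq)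
  ultimately show "card (?y ` {..<l ! i}) = card ?G"
    by (simp add: card_image[OF inj] b_def)
qed

lemma hook_lengths_row:
  assumes "is_partition l" "i < length l"
  defines "b \<equiv> l ! i + (length l - Suc i)"
  shows "(\<lambda>j. hook_length l (i, j)) ` {..<l ! i} = (\<lambda>y. b - y) ` {y. y < b \<and> y \<notin> beta_set l}"
proof -
  have "hook_length l (i, j) = b - (j + (length l - conjugate_part l j))" if "j < l ! i" for j
    using that hook_length_eq[OF assms(1,2) that] conjugate_part_le[of l j]
      less_nth_iff_conjugate_part[OF assms(1), of i j] assms(2) unfolding b_def by linarith
  then show ?thesis
    unfolding b_def beta_set_gaps_below[OF assms(1,2)] image_image by (intro image_cong) (auto simp: b_def)
qed

text \<open>Hook lengths are the differences \<open>x - y\<close> with \<open>x\<close> in the set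
  and \<open>y < x\<close> a gap. If \<open>x - t\<close> is a gap, then \<open>t\<close> itself is
  a hook length; conversely, closure carries membership from \<open>x\<close> down in steps of
  \<open>t\<close>, so no gap \<open>y\<close> is reached.\<close>

lemma is_core_iff_beta_set:
  assumes "is_partition l" "t > 0"
  shows "is_core t l \<longleftrightarrow> (\<forall>x \<in> beta_set l. t \<le> x \<longrightarrow> x - t \<in> beta_set l)"
proof -
  have "is_core t l \<longleftrightarrow>
      (\<forall>i < length l. \<forall>h \<in> (\<lambda>j. hook_length l (i, j)) ` {..<l ! i}. \<not> t dvd h)"
    using assms by (auto simp: is_core_def young_diagram_def)
  also have "\<dots> \<longleftrightarrow> (\<forall>x \<in> beta_set l. \<forall>y < x. y \<notin> beta_set l \<longrightarrow> \<not> t dvd x - y)"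
    by (auto simp: hook_lengths_row[OF assms(1)] beta_set_conv_nth[of l])
  also have "\<dots> \<longleftrightarrow> (\<forall>x \<in> beta_set l. t \<le> x \<longrightarrow> x - t \<in> beta_set l)"
  proof safe
    fix x assume *: "\<forall>x \<in> beta_set l. \<forall>y < x. y \<notin> beta_set l \<longrightarrow> \<not> t dvd x - y"
      and "x \<in> beta_set l" "t \<le> x"
    then show "x - t \<in> beta_set l"
      using assms(2) by (metis diff_diff_cancel diff_less dvd_refl less_le_trans)
  next
    fix x y assume *: "\<forall>x \<in> beta_set l. t \<le> x \<longrightarrow> x - t \<in> beta_set l"
      and xy: "x \<in> beta_set l" "y < x" "y \<notin> beta_set l" "t dvd x - y"
    have "x - t * k \<in> beta_set l" if "t * k \<le> x" for k
      using that
    proof (induction k)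
      case (Suc k)
      then have "t \<le> x - t * k" "x - t * k \<in> beta_set l" by auto
      then have "x - t * k - t \<in> beta_set l" using * by blast
      then show ?case by (simp add: add.commute)
    qed (use xy in simp)
    moreover obtain k where "x - y = t * k" using xy by auto
    then have "t * k \<le> x" "x - t * k = y" using xy by auto
    ultimately show False using xy by metis
  qed
  finally show ?thesis .
qed

section \<open>Order ideals of truncated pyramids and their recurrence\<close>

text \<open>\<open>k\<close> is the height and \<open>j\<close> the position from the left, so row
  \<open>k\<close> has \<open>n - k * p\<close> entries. The width \<open>n\<close> of the bottom
  row is a free parameter because cutting produces smaller pyramids.\<close>

definition pyramid_ideals :: "nat \<Rightarrow> nat \<Rightarrow> (nat \<times> nat) set set" where
  "pyramid_ideals p n = {D. D \<subseteq> {(k, j). j + k * p < n} \<and>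
     (\<forall>k j i. (Suc k, j) \<in> D \<longrightarrow> i \<le> p \<longrightarrow> (k, j + i) \<in> D)}"

lemma pyramid_ideals_0: "pyramid_ideals p 0 = {{}}"
  by (auto simp: pyramid_ideals_def)

lemma finite_pyramid:
  fixes n p :: nat
  assumes "p > 0"
  shows "finite {(k, j). j + k * p < n}"
proof -
  have "k < n" "j < n" if "j + k * p < n" for j k
    using that assms le_trans[of k "k * p" n] by (cases p; auto)+
  then have "{(k, j). j + k * p < n} \<subseteq> {..<n} \<times> {..<n}" by auto
  then show ?thesis by (rule finite_subset) auto
qed

lemma finite_pyramid_ideals:
  assumes "p > 0"
  shows "finite (pyramid_ideals p n)"
proof -
  have "finite (Pow {(k, j). j + k * p < n})" using finite_pyramid[OF assms] by simp
  then show ?thesis by (rule rev_finite_subset) (auto simp: pyramid_ideals_def)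
qed

text \<open>Each step down shifts the position by at most \<open>p\<close>, so \<open>k\<close>
  steps reach every shift up to \<open>k * p\<close>. Consequently nothing in an ideal stands above
  a missing entry of the bottom row.\<close>

lemma pyramid_ideal_base:
  assumes "D \<in> pyramid_ideals p n" "(k, j) \<in> D" "m \<le> k * p"
  shows "(0, j + m) \<in> D"
  using assms(2,3)
proof (induction k arbitrary: j m)
  case (Suc k)
  have "(k, j + min m p) \<in> D"
    using Suc.prems assms(1) by (simp add: pyramid_ideals_def)
  then have "(0, j + min m p + (m - min m p)) \<in> D"
    using Suc.prems by (intro Suc.IH) auto
  then show ?case by (simp add: add.assoc)
qed simp

text \<open>\<open>i\<close> is the first missing entry of the bottom row. \<open>L\<close> stands
  on the \<open>i\<close> full entries to the left and is therefore raised by one row;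
  \<open>R\<close> is shifted past column \<open>i\<close>.\<close>

definition pyramid_glue :: "nat \<Rightarrow> (nat \<times> nat) set \<times> (nat \<times> nat) set \<Rightarrow> (nat \<times> nat) set" where
  "pyramid_glue i = (\<lambda>(L, R). {0} \<times> {..<i} \<union> (\<lambda>(k, j). (Suc k, j)) ` L
     \<union> (\<lambda>(k, j). (k, j + Suc i)) ` R)"

lemma mem_pyramid_glue_0:
  "(0, j) \<in> pyramid_glue i (L, R) \<longleftrightarrow> j < i \<or> (i < j \<and> (0, j - Suc i) \<in> R)"
  by (force simp: pyramid_glue_def image_iff)

lemma mem_pyramid_glue_Suc:
  "(Suc k, j) \<in> pyramid_glue i (L, R) \<longleftrightarrow> (k, j) \<in> L \<or> (i < j \<and> (Suc k, j - Suc i) \<in> R)"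
  by (force simp: pyramid_glue_def image_iff)

lemma pyramid_glue_in:
  assumes L: "L \<in> pyramid_ideals p (i - p)" and R: "R \<in> pyramid_ideals p (n - Suc i)"
    and i: "i \<le> n"
  shows "pyramid_glue i (L, R) \<in> pyramid_ideals p n"
proof -
  have L1: "j + k * p < i - p" if "(k, j) \<in> L" for k j
    using L that by (auto simp: pyramid_ideals_def)
  have L2: "(k, j + m) \<in> L" if "(Suc k, j) \<in> L" "m \<le> p" for k j m
    using L that by (auto simp: pyramid_ideals_def)
  have R1: "j + k * p < n - Suc i" if "(k, j) \<in> R" for k j
    using R that by (auto simp: pyramid_ideals_def)
  have R2: "(k, j + m) \<in> R" if "(Suc k, j) \<in> R" "m \<le> p" for k j m
    using R that by (auto simp: pyramid_ideals_def)
  have "j + k * p < n" if "(k, j) \<in> pyramid_glue i (L, R)" for k j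
  proof (cases k)
    case 0
    then show ?thesis using that R1[of 0 "j - Suc i"] i by (auto simp: mem_pyramid_glue_0)
  next
    case (Suc k')
    then show ?thesis
      using that R1[of k "j - Suc i"] L1[of k' j] i by (auto simp: mem_pyramid_glue_Suc)
  qed
  moreover have "(k, j + m) \<in> pyramid_glue i (L, R)"
    if "(Suc k, j) \<in> pyramid_glue i (L, R)" "m \<le> p" for k j m
    using that(1) unfolding mem_pyramid_glue_Suc
  proof
    assume *: "(k, j) \<in> L"
    show ?thesis
    proof (cases k)
      case 0
      \<comment> \<open>An entry just above the bottom row covers positions \<open>j\<close> to
        \<open>j + p\<close>, all below \<open>i\<close> because \<open>L\<close> has width
        \<open>i - p\<close>.\<close>
      then show ?thesis using L1[OF *] that by (auto simp: mem_pyramid_glue_0)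
    next
      case (Suc k')
      then show ?thesis using L2[of k' j m] * that by (auto simp: mem_pyramid_glue_Suc)
    qed
  next
    assume *: "i < j \<and> (Suc k, j - Suc i) \<in> R"
    then have "(k, j - Suc i + m) \<in> R" using R2 that by blast
    with * have "i < j + m \<and> (k, j + m - Suc i) \<in> R" by auto
    then show ?thesis by (cases k) (auto simp: mem_pyramid_glue_0 mem_pyramid_glue_Suc)
  qed
  ultimately show ?thesis by (auto simp: pyramid_ideals_def)
qed

lemma pyramid_glue_surj:
  assumes D: "D \<in> pyramid_ideals p n" and i: "(0, i) \<notin> D" "\<And>j. j < i \<Longrightarrow> (0, j) \<in> D"
  shows "D \<in> pyramid_glue i ` (pyramid_ideals p (i - p) \<times> pyramid_ideals p (n - Suc i))"
proof -
  have D1: "j + k * p < n" if "(k, j) \<in> D" for k j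
    using D that by (auto simp: pyramid_ideals_def)
  have D2: "(k, j + m) \<in> D" if "(Suc k, j) \<in> D" "m \<le> p" for k j m
    using D that by (auto simp: pyramid_ideals_def)
  \<comment> \<open>An entry stands on positions \<open>j\<close> to \<open>j + k * p\<close> of the
    bottom row; as \<open>i\<close> is missing there, this interval lies entirely on one side of
    \<open>i\<close>.\<close>
  have side: "j + k * p < i \<or> i < j" if "(k, j) \<in> D" for k j
    using pyramid_ideal_base[OF D that, of "i - j"] i(1) by fastforce
  define L where "L = {(k, j). (Suc k, j) \<in> D \<and> j + k * p < i - p}"
  define R where "R = {(k, j). (k, j + Suc i) \<in> D}"
  have "L \<in> pyramid_ideals p (i - p)"
    unfolding pyramid_ideals_def L_def using D2 by auto
  moreover have "R \<in> pyramid_ideals p (n - Suc i)"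
    unfolding pyramid_ideals_def R_def
  proof safe
    fix k j assume "(k, j + Suc i) \<in> D"
    then show "j + k * p < n - Suc i" using D1 by fastforce
  next
    fix k j m assume "(Suc k, j + Suc i) \<in> D" "m \<le> p"
    then show "(k, j + m + Suc i) \<in> D" using D2[of k "j + Suc i" m] by (simp add: ac_simps)
  qed
  moreover have "(k, j) \<in> D \<longleftrightarrow> (k, j) \<in> pyramid_glue i (L, R)" for k j
  proof (cases k)
    case 0
    then show ?thesis
      using i side[of 0 j] by (auto simp: mem_pyramid_glue_0 R_def)
  next
    case (Suc k')
    then show ?thesis
      using side[of k j] by (auto simp: mem_pyramid_glue_Suc R_def L_def)
  qed
  then have "D = pyramid_glue i (L, R)" by auto
  ultimately show ?thesis by blast
qed

text \<open>The column reveals the origin of an entry: those raised from \<open>L\<close> lie left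
  of column \<open>i\<close>, those shifted from \<open>R\<close> lie right of it.\<close>

lemma pyramid_glue_inj:
  "inj_on (pyramid_glue i) (pyramid_ideals p (i - p) \<times> pyramid_ideals p (n - Suc i))"
proof -
  have sub: "L \<subseteq> L'" "R \<subseteq> R'"
    if L: "L \<in> pyramid_ideals p (i - p)" "L' \<in> pyramid_ideals p (i - p)"
      and eq: "pyramid_glue i (L, R) = pyramid_glue i (L', R')"
      for L R L' R'
  proof -
    show "L \<subseteq> L'"
    proof safe
      fix k j assume kj: "(k, j) \<in> L"
      then have "j < i" using L by (auto simp: pyramid_ideals_def)
      moreover have "(Suc k, j) \<in> pyramid_glue i (L', R')"
        using kj by (simp add: mem_pyramid_glue_Suc flip: eq)
      ultimately show "(k, j) \<in> L'" by (simp add: mem_pyramid_glue_Suc)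
    qed
  next
    have notL: "(k, j + Suc i) \<notin> L'" for k j
      using L by (auto simp: pyramid_ideals_def)
    show "R \<subseteq> R'"
    proof safe
      fix k j assume kj: "(k, j) \<in> R"
      then have "(k, j + Suc i) \<in> pyramid_glue i (L', R')"
        unfolding eq[symmetric] by (cases k) (auto simp: mem_pyramid_glue_0 mem_pyramid_glue_Suc)
      then show "(k, j) \<in> R'"
        using notL by (cases k) (auto simp: mem_pyramid_glue_0 mem_pyramid_glue_Suc)
    qed
  qed
  show ?thesis
  proof (rule inj_onI, clarify)
    fix L R L' R'
    assume *: "L \<in> pyramid_ideals p (i - p)" "L' \<in> pyramid_ideals p (i - p)"
      "pyramid_glue i (L, R) = pyramid_glue i (L', R')"
    from sub[OF *] sub[OF *(2,1) *(3)[symmetric]] show "L = L' \<and> R = R'" by blast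
  qed
qed


text \<open>Truncated subtraction is intended: for \<open>i \<le> p\<close> nothing lies over the entries to the left, and for
  \<open>i = n\<close> nothing lies to the right; both factors are then \<open>1\<close>.\<close>

lemma card_pyramid_ideals:
  assumes "p > 0"
  shows "card (pyramid_ideals p n) =
    (\<Sum>i\<le>n. card (pyramid_ideals p (i - p)) * card (pyramid_ideals p (n - Suc i)))"
proof -
  define B where "B i = pyramid_glue i ` (pyramid_ideals p (i - p) \<times> pyramid_ideals p (n - Suc i))" for i
  have cover: "pyramid_ideals p n = (\<Union>i\<le>n. B i)"
  proof (intro equalityI subsetI)
    fix D assume D: "D \<in> pyramid_ideals p n"
    \<comment> \<open>A full bottom row is the case \<open>i = n\<close>, since
      \<open>(0, n)\<close> lies outside the pyramid.\<close>
    define i where "i = (LEAST i. (0, i) \<notin> D)"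
    have n: "(0, n) \<notin> D" using D by (auto simp: pyramid_ideals_def)
    have "(0, i) \<notin> D" unfolding i_def using n by (rule LeastI)
    moreover have "i \<le> n" unfolding i_def using n by (rule Least_le)
    moreover have "\<And>j. j < i \<Longrightarrow> (0, j) \<in> D" unfolding i_def using not_less_Least by blast
    ultimately show "D \<in> (\<Union>i\<le>n. B i)" unfolding B_def using pyramid_glue_surj[OF D, of i] by blast
  next
    fix D assume "D \<in> (\<Union>i\<le>n. B i)"
    then show "D \<in> pyramid_ideals p n" by (auto simp: B_def intro: pyramid_glue_in)
  qed
  have disj: "B i \<inter> B j = {}" if "i \<noteq> j" for i j
  proof -
    \<comment> \<open>The entry \<open>(0, i)\<close> is missing from every member of
      \<open>B i\<close> but present in every member of \<open>B j\<close>.\<close>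
    have "\<not> (D \<in> B i \<and> D \<in> B j)" if "i < j" for i j D
      using that by (auto simp: B_def mem_pyramid_glue_0 dest!: arg_cong[where f = "(\<in>) (0, i)"])
    then show ?thesis using that by (meson disjoint_iff linorder_neqE_nat)
  qed
  have "card (pyramid_ideals p n) = (\<Sum>i\<le>n. card (B i))"
    unfolding cover using disj
    by (intro card_UN_disjoint) (auto simp: B_def finite_pyramid_ideals[OF assms])
  then show ?thesis
    by (simp add: B_def card_image[OF pyramid_glue_inj] card_cartesian_product)
qed

section \<open>Numbers outside the semigroup as entries of the pyramid\<close>

text \<open>The numbers from \<open>m * t\<close> to \<open>m * (t + p)\<close> are the sums of
  \<open>m\<close> generators, which can be subtracted one by one without leaving \<open>S\<close>.
  Hence a closed set without \<open>0\<close> avoids all these intervals.\<close>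

lemma zero_mem_of_multiple_interval:
  fixes S :: "nat set"
  assumes closed: "\<And>x d. x \<in> S \<Longrightarrow> t \<le> d \<Longrightarrow> d \<le> t + p \<Longrightarrow> d \<le> x \<Longrightarrow> x - d \<in> S"
    and "x \<in> S" "m * t \<le> x" "x \<le> m * (t + p)"
  shows "0 \<in> S"
  using assms(2-)
proof (induction m arbitrary: x)
  case (Suc m)
  \<comment> \<open>The smallest generator that brings \<open>x\<close> down to at most
    \<open>m * (t + p)\<close>.\<close>
  define d where "d = max t (x - m * (t + p))"
  have mt: "m * t \<le> m * (t + p)" by simp
  have x: "t + m * t \<le> x" "x \<le> t + p + m * (t + p)" using Suc.prems by auto
  have d: "t \<le> d" "d \<le> t + p" "d \<le> x" "m * t \<le> x - d" "x - d \<le> m * (t + p)"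
    using x mt unfolding d_def by linarith+
  with Suc.prems closed have "x - d \<in> S" by blast
  with d Suc.IH show ?case by blast
qed simp

text \<open>Row \<open>k\<close> lists the numbers strictly between \<open>k * (t + p)\<close> and
  \<open>(k + 1) * t\<close>; the upper bound is the condition \<open>j + k * p < t - 1\<close>.
  Subtracting \<open>t + p - i\<close> from entry \<open>(Suc k, j)\<close> gives entry
  \<open>(k, j + i)\<close>, which is the covering relation.\<close>

definition pyramid_entry :: "nat \<Rightarrow> nat \<Rightarrow> nat \<times> nat \<Rightarrow> nat" where
  "pyramid_entry p t = (\<lambda>(k, j). k * (t + p) + Suc j)"

definition closed_sets :: "nat \<Rightarrow> nat \<Rightarrow> nat set set" where
  "closed_sets p t = {S. finite S \<and> 0 \<notin> S \<and>
     (\<forall>x \<in> S. \<forall>d \<in> {t..t + p}. d \<le> x \<longrightarrow> x - d \<in> S)}"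

lemma inj_on_pyramid_entry:
  assumes "t > 0" shows "inj_on (pyramid_entry p t) {(k, j). j + k * p < t - 1}"
proof (rule inj_onI, clarify)
  fix k j k' j'
  assume *: "j + k * p < t - 1" "j' + k' * p < t - 1"
    "pyramid_entry p t (k, j) = pyramid_entry p t (k', j')"
  have "(k * (t + p) + Suc j) div (t + p) = k" if "Suc j < t + p" for k j
    using that by (intro div_nat_eqI) auto
  from this[of j k] this[of j' k'] * have "k = k'"
    by (auto simp: pyramid_entry_def)
  with * show "k = k' \<and> j = j'" by (auto simp: pyramid_entry_def)
qed


lemma bij_betw_pyramid_entry:
  assumes "p > 0" "t > 0"
  shows "bij_betw ((`) (pyramid_entry p t)) (pyramid_ideals p (t - 1)) (closed_sets p t)"
  unfolding bij_betw_def
proof (intro conjI equalityI subsetI)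
  show "inj_on ((`) (pyramid_entry p t)) (pyramid_ideals p (t - 1))"
    by (rule inj_on_subset[OF inj_on_image_Pow[OF inj_on_pyramid_entry[OF assms(2), of p]]])
       (auto simp: pyramid_ideals_def)
next
  fix S assume "S \<in> (`) (pyramid_entry p t) ` pyramid_ideals p (t - 1)"
  then obtain D where D: "D \<in> pyramid_ideals p (t - 1)" and S: "S = pyramid_entry p t ` D"
    by blast
  have "finite D"
    using D finite_pyramid[OF assms(1)] by (auto simp: pyramid_ideals_def intro: finite_subset)
  moreover have "x - d \<in> S" if "x \<in> S" "t \<le> d" "d \<le> t + p" "d \<le> x" for x d
  proof -
    from that S obtain k j where kj: "(k, j) \<in> D" "x = k * (t + p) + Suc j"
      by (auto simp: pyramid_entry_def)
    then have "j + k * p < t - 1" using D by (auto simp: pyramid_ideals_def)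
    \<comment> \<open>At height \<open>0\<close> the number is below \<open>t\<close>, so no
      \<open>d\<close> can be subtracted from it.\<close>
    with that kj obtain k' where k': "k = Suc k'" by (cases k) auto
    then have "(k', j + (t + p - d)) \<in> D"
      using D kj that unfolding pyramid_ideals_def by (auto simp del: add_diff_assoc add_diff_assoc2)
    moreover have "x - d = pyramid_entry p t (k', j + (t + p - d))"
      using kj k' that by (simp add: pyramid_entry_def)
    ultimately show ?thesis using S by blast
  qed
  ultimately show "S \<in> closed_sets p t"
    using S by (auto simp: closed_sets_def pyramid_entry_def)
next
  fix S assume S: "S \<in> closed_sets p t"
  then have cl: "x - d \<in> S" if "x \<in> S" "t \<le> d" "d \<le> t + p" "d \<le> x" for x d
    using that by (auto simp: closed_sets_def)
  have no: False if "x \<in> S" "m * t \<le> x" "x \<le> m * (t + p)" for x m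
    using zero_mem_of_multiple_interval[of S t p x m] cl that S by (auto simp: closed_sets_def)
  define D where "D = {(k, j). j + k * p < t - 1 \<and> pyramid_entry p t (k, j) \<in> S}"
  have "(k, j + i) \<in> D" if "(Suc k, j) \<in> D" "i \<le> p" for k j i
    using cl[of "pyramid_entry p t (Suc k, j)" "t + p - i"] that
    by (auto simp: D_def pyramid_entry_def algebra_simps)
  then have "D \<in> pyramid_ideals p (t - 1)"
    by (auto simp: pyramid_ideals_def D_def)
  moreover have "x \<in> pyramid_entry p t ` D" if x: "x \<in> S" for x
  proof -
    \<comment> \<open>Both \<open>r = 0\<close> and \<open>t \<le> r + k * p\<close> would put
      \<open>x\<close> into a forbidden interval, with \<open>m = k\<close> and
      \<open>m = k + 1\<close> respectively.\<close>
    define k r where "k = x div (t + p)" and "r = x mod (t + p)"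
    have xkr: "x = k * (t + p) + r" unfolding k_def r_def by (rule div_mult_mod_eq[symmetric])
    have "r < t + p" using assms by (simp add: r_def)
    have "r \<noteq> 0" using no[OF x, of k] xkr by auto
    moreover have "r + k * p < t"
      by (rule ccontr) (use no[OF x, of "Suc k"] xkr \<open>r < t + p\<close> in \<open>auto simp: algebra_simps\<close>)
    ultimately have "(k, r - 1) \<in> D" "x = pyramid_entry p t (k, r - 1)"
      using xkr x by (auto simp: D_def pyramid_entry_def)
    then show ?thesis by blast
  qed
  then have "S = pyramid_entry p t ` D" by (auto simp: D_def)
  ultimately show "S \<in> (`) (pyramid_entry p t) ` pyramid_ideals p (t - 1)" by blast
qed

section \<open>The recurrence for the number of cores\<close>

lemma simultaneous_cores_eq:
  assumes "t > 0"
  shows "{l. is_simultaneous_core {t..t + p} l} = {l. is_partition l \<and> beta_set l \<in> closed_sets p t}"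
  using assms beta_set_pos
  by (auto simp: is_simultaneous_core_def closed_sets_def is_core_iff_beta_set)

text \<open>For \<open>t = 0\<close> truncated subtraction gives the empty pyramid with its single
  ideal, which agrees with the convention \<open>num_cores p 0 = 1\<close>.\<close>

lemma num_cores_eq_card_pyramid_ideals:
  assumes "p > 0"
  shows "num_cores p (int t) = card (pyramid_ideals p (t - 1))"
proof (cases "t = 0")
  case False
  have "bij_betw beta_set {l. is_partition l \<and> beta_set l \<in> closed_sets p t} (closed_sets p t)"
  proof (rule bij_betw_subset[OF bij_betw_beta_set])
    show "beta_set ` {l. is_partition l \<and> beta_set l \<in> closed_sets p t} = closed_sets p t"
      using beta_set_surj by (fastforce simp: closed_sets_def)
  qed auto
  then have "card {l. is_simultaneous_core {t..t + p} l} = card (closed_sets p t)"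
    using False by (simp add: simultaneous_cores_eq bij_betw_same_card)
  also have "\<dots> = card (pyramid_ideals p (t - 1))"
    using bij_betw_pyramid_entry[of p t] assms False by (simp add: bij_betw_same_card)
  finally show ?thesis using False by (simp add: num_cores_def)
qed (simp add: num_cores_def pyramid_ideals_0)

lemma num_cores_neg: "t < 0 \<Longrightarrow> num_cores p t = 0"
  by (simp add: num_cores_def)

lemma num_cores_0: "num_cores p 0 = 1"
  by (simp add: num_cores_def)

text \<open>\<open>i\<close> is one more than the position of the first missing entry of the bottom
  row. The subtraction \<open>i - p\<close> is on naturals, so for \<open>i \<le> p\<close> the
  first factor is \<open>num_cores p 0 = 1\<close>.\<close>

lemma num_cores_convolution:
  assumes "p > 0" "t > 0"
  shows "num_cores p (int t) =
    (\<Sum>i=1..t. num_cores p (int (i - p)) * num_cores p (int (t - i)))"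
proof -
  have "num_cores p (int t) =
     (\<Sum>i\<le>t-1. card (pyramid_ideals p (i - p)) * card (pyramid_ideals p (t - 1 - Suc i)))"
    unfolding num_cores_eq_card_pyramid_ideals[OF assms(1)] by (rule card_pyramid_ideals[OF assms(1)])
  also have "\<dots> = (\<Sum>i=1..t. card (pyramid_ideals p (i - p - 1)) * card (pyramid_ideals p (t - i - 1)))"
    using assms by (intro sum.reindex_bij_witness[of _ "\<lambda>i. i - 1" Suc])
      (auto simp: diff_commute)
  finally show ?thesis unfolding num_cores_eq_card_pyramid_ideals[OF assms(1)] .
qed

text \<open>The convolution is split at \<open>i = p\<close>: below \<open>p\<close> the first
  factor is \<open>1\<close>, which gives the linear sum; from \<open>p\<close> on,
  \<open>j = i - p\<close> gives the quadratic one.\<close>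

lemma num_cores_recurrence_nat:
  assumes "p > 0" "t > 0"
  shows "num_cores p (int t) = (\<Sum>i=1..p-1. num_cores p (int t - int i))
     + (\<Sum>j\<in>{j. j + p \<le> t}. num_cores p (int j) * num_cores p (int (t - p - j)))"
proof -
  let ?f = "\<lambda>i. num_cores p (int (i - p)) * num_cores p (int (t - i))"
  have nonneg: "i \<le> t" if "0 < num_cores p (int t - int i)" for i
    using that num_cores_neg[of "int t - int i" p] by fastforce
  have split: "{1..t} = {i\<in>{1..t}. i < p} \<union> {p..t}" using assms by auto
  have "num_cores p (int t) = sum ?f {1..t}"
    by (rule num_cores_convolution[OF assms])
  also have "\<dots> = sum ?f ({i\<in>{1..t}. i < p} \<union> {p..t})"
    by (rule arg_cong[where f = "sum ?f", OF split])
  also have "\<dots> = sum ?f {i\<in>{1..t}. i < p} + sum ?f {p..t}"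
    by (rule sum.union_disjoint) auto
  \<comment> \<open>The sum on the right may run past \<open>t\<close>; the extra terms have
    negative index and vanish.\<close>
  also have "sum ?f {i\<in>{1..t}. i < p} = (\<Sum>i=1..p-1. num_cores p (int t - int i))"
    by (rule sum.mono_neutral_cong_left) (auto simp: num_cores_0 of_nat_diff dest: nonneg)
  also have "sum ?f {p..t} = (\<Sum>j\<in>{j. j + p \<le> t}. num_cores p (int j) * num_cores p (int (t - p - j)))"
    by (rule sum.reindex_bij_witness[of _ "\<lambda>j. j + p" "\<lambda>i. i - p"]) auto
  finally show ?thesis .
qed

lemma num_cores_recurrence:
  assumes "p > 0" "t \<ge> (1::int)"
  shows "num_cores p t = (\<Sum>i = 1..int p - 1. num_cores p (t - i))
              + (\<Sum>j = 0..t - int p. num_cores p j * num_cores p (t - int p - j))"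
proof -
  from assms obtain s where s: "t = int s" "s > 0"
    by (metis int_one_le_iff_zero_less nonneg_int_cases zero_le_one order_trans of_nat_0_less_iff)
  have "(\<Sum>i=1..p-1. num_cores p (int s - int i)) = (\<Sum>i = 1..int p - 1. num_cores p (t - i))"
    using s by (intro sum.reindex_bij_witness[of _ nat int]) auto
  moreover have "(\<Sum>j\<in>{j. j + p \<le> s}. num_cores p (int j) * num_cores p (int (s - p - j)))
      = (\<Sum>j = 0..t - int p. num_cores p j * num_cores p (t - int p - j))"
    using s by (intro sum.reindex_bij_witness[of _ nat int]) (auto simp: of_nat_diff diff_diff_eq)
  ultimately show ?thesis using num_cores_recurrence_nat[OF assms(1) s(2)] s by simp
qed

section \<open>The generating function\<close>

lemma num_cores_fps_equation:
  fixes p :: nat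
  assumes "p > 0"
  defines "F \<equiv> Abs_fps (\<lambda>t::nat. real (num_cores p (int t)))"
  shows "F = 1 + (\<Sum>i = 1..p - 1. fps_X ^ i) * F + fps_X ^ p * F ^ 2"
proof (rule fps_ext)
  fix t
  have "fps_nth ((\<Sum>i = 1..p - 1. fps_X ^ i) * F) t = real (\<Sum>i=1..p-1. num_cores p (int t - int i))"
    by (simp add: sum_distrib_right fps_sum_nth fps_X_power_mult_nth F_def)
       (auto intro!: sum.cong simp: num_cores_neg of_nat_diff)
  moreover have "fps_nth (fps_X ^ p * F ^ 2) t =
     real (\<Sum>j\<in>{j. j + p \<le> t}. num_cores p (int j) * num_cores p (int (t - p - j)))"
  proof (cases "t < p")
    case False
    then have "{j. j + p \<le> t} = {0..t - p}" by auto
    then show ?thesis using False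
      by (simp add: fps_X_power_mult_nth) (simp add: power2_eq_square fps_mult_nth F_def)
  next
    case True
    then have "{j. j + p \<le> t} = {}" by auto
    with True show ?thesis by (simp only:) (simp add: fps_X_power_mult_nth)
  qed
  moreover have "t > 0 \<Longrightarrow> fps_nth F t = real (\<Sum>i=1..p-1. num_cores p (int t - int i)) +
     real (\<Sum>j\<in>{j. j + p \<le> t}. num_cores p (int j) * num_cores p (int (t - p - j)))"
    using num_cores_recurrence_nat[OF assms(1), of t] by (simp add: F_def)
  ultimately show "fps_nth F t = fps_nth (1 + (\<Sum>i = 1..p - 1. fps_X ^ i) * F + fps_X ^ p * F ^ 2) t"
    using assms(1)
    by (cases "t = 0") (auto simp: F_def num_cores_0 num_cores_neg)
qed

text \<open>Real formal power series form an integral domain, so two square roots of a series differ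
  only by sign, and the constant term fixes the sign.\<close>

lemma fps_sqrt_unique:
  assumes "b ^ 2 = a" "fps_nth b 0 = 1"
  shows "fps_sqrt a = b"
proof -
  have a: "fps_nth a 0 = 1" using assms by (auto simp: power2_eq_square)
  then have "fps_sqrt a = b \<or> fps_sqrt a = - b"
    using fps_sqrt_power2[OF a] assms(1) by (simp flip: power2_eq_iff)
  then show ?thesis using fps_sqrt_nth_0[OF a] assms(2) by auto
qed

theorem theorem3p3:
  fixes p :: nat
  assumes "p > 0"
  shows "(\<forall>t::int. t \<ge> 1 \<longrightarrow>
            num_cores p t = (\<Sum>i = 1..int p - 1. num_cores p (t - i))
              + (\<Sum>j = 0..t - int p. num_cores p j * num_cores p (t - int p - j))) \<and>
         (let F = Abs_fps (\<lambda>t::nat. real (num_cores p (int t)));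
              A = 1 - (\<Sum>i = 1..p - 1. fps_X ^ i) :: real fps;
              N = A - fps_sqrt (A ^ 2 - 4 * fps_X ^ p)
          in 2 * fps_X ^ p dvd N \<and> F = N / (2 * fps_X ^ p))"
proof -
  define F where "F = Abs_fps (\<lambda>t::nat. real (num_cores p (int t)))"
  define A :: "real fps" where "A = 1 - (\<Sum>i = 1..p - 1. fps_X ^ i)"
  have "F = 1 + (1 - A) * F + fps_X ^ p * F ^ 2"
    using num_cores_fps_equation[OF assms] by (simp add: F_def A_def)
  then have "A * F = 1 + fps_X ^ p * F ^ 2"
    by (simp add: algebra_simps)
  moreover have "(A - 2 * fps_X ^ p * F) ^ 2 =
      A ^ 2 - 4 * fps_X ^ p * (A * F - fps_X ^ p * F ^ 2)"
    by (simp add: power2_eq_square algebra_simps)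
  ultimately have "(A - 2 * fps_X ^ p * F) ^ 2 = A ^ 2 - 4 * fps_X ^ p"
    by simp
  moreover have "fps_nth (A - 2 * fps_X ^ p * F) 0 = 1"
    using assms by (simp add: A_def fps_sum_nth mult.assoc)
  ultimately have "A - fps_sqrt (A ^ 2 - 4 * fps_X ^ p) = 2 * fps_X ^ p * F"
    by (simp add: fps_sqrt_unique)
  \<comment> \<open>Divisibility is immediate from the product; a nonzero divisor cancels, so the
    quotient is exactly \<open>F\<close>.\<close>
  moreover have "2 * fps_X ^ p \<noteq> (0 :: real fps)"
    by simp
  ultimately show ?thesis
    unfolding Let_def F_def[symmetric] A_def[symmetric]
    using num_cores_recurrence[OF assms] by simp
qed

end
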